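(* Let $a<b$, $c<d$, $\Delta=[a,b]\times[c,d]\subset[0,\infty)^2$, and let $f:\Delta\to[0,\infty)$ be an absolutely continuous function on $\Delta$. Let $s\in(0,1]$, $p>1$, $q=\frac{p}{p-1}$, and $r_1,r_2\in[0,1]$ be fixed. If $\left|\frac{\partial^2 f}{\partial t\partial\lambda}\right|^{\frac{p}{p-1}}$ is an $s$-convex function on the co-ordinates on $\Delta$, then $$\Bigg|\frac{f(a,c)+r_2f(a,d)+r_1f(b,c)+r_1r_2f(b,d)}{(r_1+1)(r_2+1)}-\left(\frac{r_1}{r_1+1}\right)\frac{1}{d-c}\int_c^d f(b,y)\,dy-\left(\frac{1}{r_1+1}\right)\frac{1}{d-c}\int_c^d f(a,y)\,dy$$ $$-\left(\frac{r_2}{r_2+1}\right)\frac{1}{b-a}\int_a^b f(x,d)\,dx-\left(\frac{1}{r_2+1}\right)\frac{1}{b-a}\int_a^b f(x,c)\,dx+\frac{1}{(b-a)(d-c)}\int_a^b\int_c^d f(x,y)\,dx\,dy\Bigg|$$ $$\le\frac{(b-a)(d-c)}{(r_1+1)(r_2+1)}\left(\frac{\left(1+r_1^{\frac{p+1}{p}}\right)\left(1+r_2^{\frac{p+1}{p}}\right)}{(r_1+1)^{\frac1p}(r_2+1)^{\frac1p}(p+1)^{\frac2p}}\right)$$ $$\times\left(\frac{\left|\frac{\partial^2 f}{\partial t\partial\lambda}\right|^q(a,c)+\left|\frac{\partial^2 f}{\partial t\partial\lambda}\right|^q(a,d)+\left|\frac{\partial^2 f}{\partial t\partial\lambda}\right|^q(b,c)+\left|\frac{\partial^2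 f}{\partial t\partial\lambda}\right|^q(b,d)}{(s+1)^2}\right)^{\frac1q}.$$
   Context: $\frac{\partial^2 f}{\partial t\partial\lambda}$ denotes the second-order mixed partial derivative of $f$ with respect to its first and second variables, on $\Delta$. In $\int_a^b\int_c^d f(x,y)\,dx\,dy$ the variable $x$ ranges over $[a,b]$ and $y$ over $[c,d]$. For fixed $s\in(0,1]$, a real function $h$ on an interval in $[0,\infty)$ is $s$-convex (in the second sense) if $h(\alpha x+\beta y)\le\alpha^s h(x)+\beta^s h(y)$ for all $x,y$ in the interval and $\alpha,\beta\ge0$ with $\alpha+\beta=1$. A function $g:[a,b]\times[c,d]\to\mathbb{R}$ is $s$-convex on the co-ordinates if the partial mappings $u\mapsto g(u,y)$ on $[a,b]$ (for every $y\in[c,d]$) and $v\mapsto g(x,v)$ on $[c,d]$ (for every $x\in[a,b]$) are $s$-convex in this sense. *)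

theory Defs
  imports "HOL-Analysis.Analysis"
begin

definition s_convex_on :: "real \<Rightarrow> real set \<Rightarrow> (real \<Rightarrow> real) \<Rightarrow> bool" where
  "s_convex_on s I h \<longleftrightarrow>
     (\<forall>x\<in>I. \<forall>y\<in>I. \<forall>\<alpha>\<ge>0. \<forall>\<beta>\<ge>0. \<alpha> + \<beta> = 1 \<longrightarrow>
        h (\<alpha> * x + \<beta> * y) \<le> \<alpha> powr s * h x + \<beta> powr s * h y)"

definition coord_s_convex_on ::
    "real \<Rightarrow> real set \<Rightarrow> real set \<Rightarrow> (real \<times> real \<Rightarrow> real) \<Rightarrow> bool" where
  "coord_s_convex_on s A B g \<longleftrightarrow>
     (\<forall>y\<in>B. s_convex_on s A (\<lambda>u. g (u, y))) \<and>
     (\<forall>x\<in>A. s_convex_on s B (\<lambda>v. g (x, v)))"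

text \<open>
  The mixed derivative is taken in the order suggested by the notation
  \<open>\<partial>\<^sup>2f/\<partial>t\<partial>\<lambda> = \<partial>/\<partial>t (\<partial>f/\<partial>\<lambda>)\<close>: first in the second variable, then in the
  first. It is required at every point of \<open>A \<times> B\<close>; since \<open>f\<close> is only given
  there, derivatives at boundary points are one-sided. On nondegenerate
  intervals both \<open>g\<close> and \<open>f'\<close> are uniquely determined on \<open>A \<times> B\<close>.
\<close>

definition has_mixed_partial_on ::
    "(real \<times> real \<Rightarrow> real) \<Rightarrow> (real \<times> real \<Rightarrow> real) \<Rightarrow> real set \<Rightarrow> real set \<Rightarrow> bool" where
  "has_mixed_partial_on f f' A B \<longleftrightarrow>
     (\<exists>g. \<forall>x\<in>A. \<forall>y\<in>B.
        ((\<lambda>v. f (x, v)) has_real_derivative g (x, y)) (at y within B) \<and>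
        ((\<lambda>u. g (u, y)) has_real_derivative f' (x, y)) (at x within A))"

text \<open>
  In \<open>D division_of S\<close> the set \<open>D\<close> is an arbitrary finite family of nonoverlapping
  closed boxes, because \<open>S\<close> is only constrained to lie in the domain. Degenerate
  boxes are allowed but contribute \<open>0\<close> to both sums.
\<close>

definition abs_cont_on :: "real \<Rightarrow> real \<Rightarrow> (real \<Rightarrow> real) \<Rightarrow> bool" where
  "abs_cont_on a b h \<longleftrightarrow>
     (\<forall>\<epsilon>>0. \<exists>\<delta>>0. \<forall>D S. D division_of S \<and> S \<subseteq> {a..b} \<and> (\<Sum>K\<in>D. measure lborel K) < \<delta> \<longrightarrow>
        (\<Sum>K\<in>D. \<bar>h (interval_upperbound K) - h (interval_lowerbound K)\<bar>) < \<epsilon>)"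

definition rect_increment :: "(real \<times> real \<Rightarrow> real) \<Rightarrow> (real \<times> real) set \<Rightarrow> real" where
  "rect_increment f K =
     (let (x1, y1) = interval_lowerbound K; (x2, y2) = interval_upperbound K
      in f (x2, y2) - f (x1, y2) - f (x2, y1) + f (x1, y1))"

text \<open>
  Absolute continuity of a function of two variables, in the sense of Caratheodory:
  the associated rectangle function is absolutely continuous, and so are the
  restrictions of \<open>f\<close> to the two edges of the rectangle through \<open>(a, c)\<close>.
\<close>

definition abs_cont2_on ::
    "real \<Rightarrow> real \<Rightarrow> real \<Rightarrow> real \<Rightarrow> (real \<times> real \<Rightarrow> real) \<Rightarrow> bool" where
  "abs_cont2_on a b c d f \<longleftrightarrow>
     (\<forall>\<epsilon>>0. \<exists>\<delta>>0. \<forall>D S.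
        D division_of S \<and> S \<subseteq> {a..b} \<times> {c..d} \<and> (\<Sum>K\<in>D. measure lborel K) < \<delta> \<longrightarrow>
        (\<Sum>K\<in>D. \<bar>rect_increment f K\<bar>) < \<epsilon>) \<and>
     abs_cont_on a b (\<lambda>x. f (x, c)) \<and>
     abs_cont_on c d (\<lambda>y. f (a, y))"

end

theory Submission
  imports Defs
begin

text \<open>Let \<open>L\<^sub>r h = (h a + r * h b) / (r + 1) - mean h\<close>. The quantity to be estimated is \<open>L\<^sub>r\<^sub>1\<close> in the
  first variable composed with \<open>L\<^sub>r\<^sub>2\<close> in the second, applied to \<open>f\<close>. Integration by parts turns
  \<open>L\<^sub>r h\<close> into the integral of \<open>h'\<close> against an affine kernel. Hoelder's inequality, applied to a
  continuous majorant of \<open>\<bar>h'\<bar>\<^sup>q\<close> provided by \<open>s\<close>-convexity, then bounds \<open>\<bar>L\<^sub>r h\<bar>\<close>.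
  This one-dimensional bound is used twice: for \<open>h = \<partial>f/\<partial>\<lambda>(\<cdot>, y)\<close>, which bounds the derivative of
  \<open>\<Phi> y = L\<^sub>r\<^sub>1 f(\<cdot>, y)\<close>, and then for \<open>h = \<Phi>\<close>. No measurability or integrability of \<open>f'\<close> on the
  rectangle is needed.\<close>

section \<open>Integrals of powers, Hoelder's inequality and subadditivity of powers\<close>

text \<open>Allowing either sign of \<open>m\<close> covers increasing and decreasing bases alike.
  Nonnegativity at both ends together with \<open>m \<noteq> 0\<close> makes the base positive
  inside; it may vanish at an endpoint, so the fundamental theorem is used with derivatives in the
  interior only.\<close>

lemma has_integral_powr_affine:
  fixes m n e l u :: real
  assumes "l \<le> u" "m \<noteq> 0" "0 < e" and nonneg: "0 \<le> m * l + n" "0 \<le> m * u + n"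
  shows "((\<lambda>x. (m * x + n) powr e) has_integral
           ((m * u + n) powr (e + 1) - (m * l + n) powr (e + 1)) / (m * (e + 1))) {l..u}"
proof -
  define F where "F x = (m * x + n) powr (e + 1) / (m * (e + 1))" for x
  have pos: "0 < m * x + n" if "x \<in> {l<..<u}" for x
  proof (cases "m > 0")
    case True
    then have "m * l < m * x" using that by simp
    then show ?thesis using nonneg by linarith
  next
    case False
    then have "m * u < m * x" using that \<open>m \<noteq> 0\<close> by simp
    then show ?thesis using nonneg by linarith
  qed
  have nn: "0 \<le> m * x + n" if "x \<in> {l..u}" for x
    using pos[of x] nonneg that by (cases "x = l \<or> x = u") auto
  have "((\<lambda>x. (m * x + n) powr e) has_integral F u - F l) {l..u}"
  proof (rule fundamental_theorem_of_calculus_interior[OF \<open>l \<le> u\<close>])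
    show "continuous_on {l..u} F"
      unfolding F_def using nn assms by (intro continuous_intros continuous_on_powr') auto
    fix x assume "x \<in> {l<..<u}"
    from pos[OF this] show "(F has_vector_derivative (m * x + n) powr e) (at x)"
      unfolding F_def has_real_derivative_iff_has_vector_derivative[symmetric]
      using assms by (auto intro!: derivative_eq_intros)
  qed
  then show ?thesis by (simp add: F_def diff_divide_distrib)
qed

text \<open>Young's inequality for \<open>u x / N\<close> and \<open>v x / V\<close>, where
  \<open>N\<close> and \<open>V\<close> are the norms of \<open>u\<close> and \<open>v\<close> with
  exponents \<open>p\<close> and \<open>q\<close>, integrates to this bound because the two terms on
  its right contribute \<open>1 / p\<close> and \<open>1 / q\<close>. Dividing by the norms requires
  \<open>A\<close> and \<open>B\<close> to be positive.\<close>

lemma Holder_integral_le: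
  fixes u v :: "'n::euclidean_space \<Rightarrow> real"
  assumes pq: "1 < p" "1 < q" "1 / p + 1 / q = 1"
    and nonneg: "\<And>x. x \<in> S \<Longrightarrow> 0 \<le> u x" "\<And>x. x \<in> S \<Longrightarrow> 0 \<le> v x"
    and A: "((\<lambda>x. u x powr p) has_integral A) S" "0 < A"
    and B: "((\<lambda>x. v x powr q) has_integral B) S" "0 < B"
    and uv: "(\<lambda>x. u x * v x) integrable_on S"
  shows "integral S (\<lambda>x. u x * v x) \<le> A powr (1 / p) * B powr (1 / q)"
proof -
  define N V where "N = A powr (1 / p)" and "V = B powr (1 / q)"
  have pos: "N > 0" "V > 0" using A B by (auto simp: N_def V_def)
  have NV: "N powr p = A" "V powr q = B" using pq A B by (auto simp: N_def V_def powr_powr)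
  have le: "u x * v x \<le> N * V * (u x powr p / (A * p) + v x powr q / (B * q))" if "x \<in> S" for x
  proof -
    have "(u x / N) * (v x / V) \<le> (u x / N) powr p / p + (v x / V) powr q / q"
      using nonneg[OF that] pos pq by (intro Youngs_inequality) auto
    also have "\<dots> = u x powr p / (A * p) + v x powr q / (B * q)"
      using nonneg[OF that] pos by (simp add: powr_divide NV)
    finally show ?thesis using pos by (simp add: field_simps)
  qed
  have "((\<lambda>x. N * V * (u x powr p / (A * p) + v x powr q / (B * q))) has_integral
      N * V * (A / (A * p) + B / (B * q))) S"
    by (intro has_integral_mult_right has_integral_add has_integral_divide A B)
  moreover have "A / (A * p) + B / (B * q) = 1" using A B pq by simp
  ultimately have "((\<lambda>x. N * V * (u x powr p / (A * p) + v x powr q / (B * q))) has_integral N * V) S"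
    by simp
  from has_integral_le[OF integrable_integral[OF uv] this le] show ?thesis
    by (simp add: N_def V_def)
qed

text \<open>Splitting off a factor \<open>1 + x\<close> leaves the exponent
  \<open>t - 1 \<le> 0\<close>, so shrinking the base to \<open>1\<close> in one term and to
  \<open>x\<close> in the other increases both.\<close>

lemma one_plus_powr_le:
  fixes x t :: real
  assumes "0 \<le> x" "0 < t" "t \<le> 1"
  shows "(1 + x) powr t \<le> 1 + x powr t"
proof (cases "x = 0")
  case False
  then have x: "x > 0" using assms by simp
  have "(1 + x) powr t = (1 + x) powr (t - 1) + x * (1 + x) powr (t - 1)"
    using x powr_add[of "1 + x" 1 "t - 1"] by (simp add: algebra_simps)
  also have "\<dots> \<le> 1 powr (t - 1) + x * x powr (t - 1)"
    using x assms by (intro add_mono mult_left_mono powr_mono2') auto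
  also have "x * x powr (t - 1) = x powr t"
    using x powr_add[of x 1 "t - 1"] by simp
  finally show ?thesis by simp
qed (use assms in simp)

section \<open>The one-dimensional estimate\<close>

text \<open>Error of a two-point quadrature rule for the mean of \<open>h\<close>:
  \<open>r = 1\<close> gives the trapezoidal rule, \<open>r = 0\<close> the left endpoint
  rule.\<close>

definition endpoint_gap :: "real \<Rightarrow> real \<Rightarrow> real \<Rightarrow> (real \<Rightarrow> real) \<Rightarrow> real" where
  "endpoint_gap r a b h = (h a + r * h b) / (r + 1) - integral {a..b} h / (b - a)"

text \<open>The kernel is the antiderivative of \<open>1 / (b - a)\<close> whose values at \<open>a\<close> and \<open>b\<close> are
  \<open>- 1 / (r + 1)\<close> and \<open>r / (r + 1)\<close>, so that integration by parts reproduces the endpoint terms.\<close>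

definition gap_kernel :: "real \<Rightarrow> real \<Rightarrow> real \<Rightarrow> real \<Rightarrow> real" where
  "gap_kernel r a b x = (x - a) / (b - a) - 1 / (r + 1)"

text \<open>The fundamental theorem for the gauge integral applies to \<open>h\<close> times the
  kernel under pointwise differentiability alone. As \<open>h\<close> is continuous, the term
  \<open>h x / (b - a)\<close> can be subtracted, which makes integrability of the kernel times
  \<open>h'\<close> a conclusion.\<close>

lemma has_integral_gap_kernel:
  assumes "a < b" "0 \<le> r"
    and der: "\<And>x. x \<in> {a..b} \<Longrightarrow> (h has_real_derivative h' x) (at x within {a..b})"
  shows "((\<lambda>x. gap_kernel r a b x * h' x) has_integral endpoint_gap r a b h) {a..b}"
proof -
  define k where "k = gap_kernel r a b"
  have "((\<lambda>x. h x * (1 / (b - a)) + h' x * k x) has_integral h b * k b - h a * k a) {a..b}"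
  proof (rule fundamental_theorem_of_calculus)
    fix x assume "x \<in> {a..b}"
    then show "((\<lambda>x. h x * k x) has_vector_derivative h x * (1 / (b - a)) + h' x * k x) (at x within {a..b})"
      unfolding has_real_derivative_iff_has_vector_derivative[symmetric] k_def gap_kernel_def
      using assms(1) by (auto intro!: derivative_eq_intros der)
  qed (use assms in simp)
  moreover have "h integrable_on {a..b}"
    by (intro integrable_continuous_real) (meson DERIV_continuous_on der)
  then have "((\<lambda>x. h x * (1 / (b - a))) has_integral integral {a..b} h * (1 / (b - a))) {a..b}"
    by (intro has_integral_mult_left integrable_integral)
  ultimately have "((\<lambda>x. (h x * (1 / (b - a)) + h' x * k x) - h x * (1 / (b - a))) has_integral
      (h b * k b - h a * k a) - integral {a..b} h * (1 / (b - a))) {a..b}"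
    by (rule has_integral_diff)
  moreover have "(h b * k b - h a * k a) - integral {a..b} h * (1 / (b - a)) = endpoint_gap r a b h"
  proof -
    have "k b = r / (r + 1)" "k a = - 1 / (r + 1)"
      using assms by (auto simp: k_def gap_kernel_def field_simps)
    then show ?thesis by (simp add: endpoint_gap_def add_divide_distrib mult.commute)
  qed
  ultimately show ?thesis by (simp add: k_def mult.commute)
qed

text \<open>The kernel is affine and increasing; the parts to the left and right of its zero
  contribute the summands \<open>1\<close> and \<open>r powr (p + 1)\<close>.\<close>

lemma has_integral_abs_gap_kernel_powr:
  assumes "a < b" "0 \<le> r" "0 < p"
  shows "((\<lambda>x. \<bar>gap_kernel r a b x\<bar> powr p) has_integral
           (b - a) * (1 + r powr (p + 1)) / ((p + 1) * (r + 1) powr (p + 1))) {a..b}"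
proof -
  \<comment> \<open>\<open>c\<close> is the zero of the kernel; it divides \<open>{a..b}\<close> in
    the ratio \<open>1 : r\<close>.\<close>
  define c where "c = a + (b - a) / (r + 1)"
  define m where "m = 1 / (b - a)"
  define n where "n = - a / (b - a) - 1 / (r + 1)"
  have mpos: "m > 0" using assms by (simp add: m_def)
  have k: "gap_kernel r a b x = m * x + n" for x
    by (simp add: gap_kernel_def m_def n_def diff_divide_distrib)
  have "(b - a) / (r + 1) \<le> (b - a) / 1" using assms by (intro divide_left_mono) auto
  then have c: "a \<le> c" "c \<le> b" using assms by (auto simp: c_def)
  have ka: "m * a + n = - (1 / (r + 1))"
    using assms by (simp add: m_def n_def)
  have kb: "m * b + n = r / (r + 1)"
  proof -
    have "m * (b - a) = 1" using assms by (simp add: m_def)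
    then have "m * b + n = 1 - 1 / (r + 1)" using ka by (simp add: algebra_simps)
    then show ?thesis using assms by (simp add: field_simps)
  qed
  have kc: "m * c + n = 0"
    using assms by (simp add: m_def n_def c_def add_divide_distrib)
  have "0 \<le> - m * a + - n"
  proof -
    have "- m * a + - n = 1 / (r + 1)" using ka by simp
    then show ?thesis using \<open>0 \<le> r\<close> by simp
  qed
  \<comment> \<open>The kernel is nonpositive on \<open>{a..c}\<close>, so its absolute value is
    affine with slope \<open>- m\<close>, written with \<open>+ - n\<close> to fit
    \<open>has_integral_powr_affine\<close>.\<close>
  then have "((\<lambda>x. (- m * x + - n) powr p) has_integral
      ((- m * c + - n) powr (p + 1) - (- m * a + - n) powr (p + 1)) / (- m * (p + 1))) {a..c}"
    using mpos assms ka kc c by (intro has_integral_powr_affine) auto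
  moreover have "(- m * x + - n) powr p = \<bar>gap_kernel r a b x\<bar> powr p" if "x \<in> {a..c}" for x
  proof -
    have "m * x \<le> m * c" using that mpos by simp
    then have "\<bar>m * x + n\<bar> = - m * x + - n" using kc by simp
    then show ?thesis by (simp only: k)
  qed
  moreover have "((- m * c + - n) powr (p + 1) - (- m * a + - n) powr (p + 1)) / (- m * (p + 1))
      = (b - a) * (1 / (r + 1)) powr (p + 1) / (p + 1)"
  proof -
    have "- m * c + - n = 0" "- m * a + - n = 1 / (r + 1)" using ka kc by auto
    then show ?thesis using assms by (simp only:) (simp add: m_def field_simps)
  qed
  ultimately have 1: "((\<lambda>x. \<bar>gap_kernel r a b x\<bar> powr p) has_integral
      (b - a) * (1 / (r + 1)) powr (p + 1) / (p + 1)) {a..c}"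
    using has_integral_cong by (metis (no_types, lifting))
  have "((\<lambda>x. (m * x + n) powr p) has_integral
      ((m * b + n) powr (p + 1) - (m * c + n) powr (p + 1)) / (m * (p + 1))) {c..b}"
    using mpos assms kb kc c by (intro has_integral_powr_affine) auto
  moreover have "(m * x + n) powr p = \<bar>gap_kernel r a b x\<bar> powr p" if "x \<in> {c..b}" for x
  proof -
    have "m * c \<le> m * x" using that mpos by simp
    then have "\<bar>m * x + n\<bar> = m * x + n" using kc by simp
    then show ?thesis by (simp only: k)
  qed
  moreover have "((m * b + n) powr (p + 1) - (m * c + n) powr (p + 1)) / (m * (p + 1))
      = (b - a) * (r / (r + 1)) powr (p + 1) / (p + 1)"
    unfolding kb kc using assms by (simp add: m_def field_simps)
  ultimately have 2: "((\<lambda>x. \<bar>gap_kernel r a b x\<bar> powr p) has_integral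
      (b - a) * (r / (r + 1)) powr (p + 1) / (p + 1)) {c..b}"
    using has_integral_cong by (metis (no_types, lifting))
  have "(b - a) * (1 / (r + 1)) powr (p + 1) / (p + 1) + (b - a) * (r / (r + 1)) powr (p + 1) / (p + 1)
      = (b - a) * (1 + r powr (p + 1)) / ((p + 1) * (r + 1) powr (p + 1))"
  proof -
    have "D * (1 / X) / e + D * (R / X) / e = D * (1 + R) / (e * X)" for D X R e :: real
      by (simp add: add_divide_distrib distrib_left mult.commute)
    then show ?thesis using assms by (simp only: powr_divide powr_one_eq_one)
  qed
  then show ?thesis using has_integral_combine[OF c 1 2] by simp
qed

text \<open>The factor of the one-dimensional bound that does not depend on the interval. The
  exponent \<open>1 - 1 / p\<close> is \<open>1 / q\<close> expressed through
  \<open>p\<close>.\<close>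

definition gap_const :: "real \<Rightarrow> real \<Rightarrow> real \<Rightarrow> real" where
  "gap_const p s r = (1 + r powr ((p + 1) / p)) /
     ((r + 1) * (r + 1) powr (1 / p) * (p + 1) powr (1 / p) * (s + 1) powr (1 - 1 / p))"

text \<open>The bound is the norm of the kernel times that of the \<open>q\<close>-th root of the
  majorant. \<open>P\<close> and \<open>Q\<close> are the endpoint values of the majorant and may
  differ from those of \<open>\<bar>h' x\<bar> powr q\<close>: in the second application they carry
  a constant from the first.\<close>

lemma endpoint_gap_bound:
  assumes "a < b" "0 \<le> r" and pq: "1 < p" "1 < q" "1 / p + 1 / q = 1" and "0 < s"
    and PQ: "0 \<le> P" "0 \<le> Q"
    and der: "\<And>x. x \<in> {a..b} \<Longrightarrow> (h has_real_derivative h' x) (at x within {a..b})"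
    and bound: "\<And>x. x \<in> {a..b} \<Longrightarrow>
      \<bar>h' x\<bar> powr q \<le> ((b - x) / (b - a)) powr s * P + ((x - a) / (b - a)) powr s * Q"
  shows "\<bar>endpoint_gap r a b h\<bar> \<le> (b - a) * gap_const p s r * (P + Q) powr (1 / q)"
proof -
  define w where "w x = ((b - x) / (b - a)) powr s * P + ((x - a) / (b - a)) powr s * Q" for x
  define k where "k = gap_kernel r a b"
  have w0: "0 \<le> w x" for x using PQ by (simp add: w_def)
  have h'_le: "\<bar>h' x\<bar> \<le> w x powr (1 / q)" if "x \<in> {a..b}" for x
  proof -
    have "(\<bar>h' x\<bar> powr q) powr (1 / q) \<le> w x powr (1 / q)"
      using bound[OF that] pq by (intro powr_mono2) (auto simp: w_def)
    then show ?thesis using pq by (simp add: powr_powr)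
  qed
  have contw: "continuous_on {a..b} w"
    unfolding w_def using assms by (intro continuous_intros continuous_on_powr') auto
  have cont: "continuous_on {a..b} (\<lambda>x. \<bar>k x\<bar> * w x powr (1 / q))"
    unfolding k_def gap_kernel_def using assms w0
    by (intro continuous_intros continuous_on_powr' contw) auto
  have int: "((\<lambda>x. k x * h' x) has_integral endpoint_gap r a b h) {a..b}"
    unfolding k_def by (rule has_integral_gap_kernel) (use assms in auto)
  \<comment> \<open>This replaces \<open>h'\<close> by a continuous function, so that Hoelder's
    inequality is applied to continuous functions only.\<close>
  have "norm (integral {a..b} (\<lambda>x. k x * h' x)) \<le> integral {a..b} (\<lambda>x. \<bar>k x\<bar> * w x powr (1 / q))"
    using h'_le
    by (intro integral_norm_bound_integral has_integral_integrable[OF int]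
          integrable_continuous_real[OF cont])
       (auto simp: abs_mult intro!: mult_left_mono)
  then have 1: "\<bar>endpoint_gap r a b h\<bar> \<le> integral {a..b} (\<lambda>x. \<bar>k x\<bar> * w x powr (1 / q))"
    using int by (simp add: integral_unique)
  define A where "A = (b - a) * (1 + r powr (p + 1)) / ((p + 1) * (r + 1) powr (p + 1))"
  define B where "B = (b - a) * (P + Q) / (s + 1)"
  have A: "((\<lambda>x. \<bar>k x\<bar> powr p) has_integral A) {a..b}"
    unfolding A_def k_def using assms by (intro has_integral_abs_gap_kernel_powr) auto
  have "1 + r powr (p + 1) > 0" using powr_ge_zero[of r "p + 1"] by linarith
  then have Apos: "A > 0" using assms unfolding A_def
    by (intro divide_pos_pos mult_pos_pos) auto
  have B: "(w has_integral B) {a..b}"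
  proof -
    \<comment> \<open>Both weights are powers of affine functions, written in the form
      \<open>m * x + n\<close>; each integrates to \<open>(b - a) / (s + 1)\<close>.\<close>
    have "((\<lambda>x. (- 1 / (b - a) * x + b / (b - a)) powr s * P
            + (1 / (b - a) * x + - a / (b - a)) powr s * Q) has_integral
        ((- 1 / (b - a) * b + b / (b - a)) powr (s + 1) - (- 1 / (b - a) * a + b / (b - a)) powr (s + 1))
            / (- 1 / (b - a) * (s + 1)) * P
        + ((1 / (b - a) * b + - a / (b - a)) powr (s + 1) - (1 / (b - a) * a + - a / (b - a)) powr (s + 1))
            / (1 / (b - a) * (s + 1)) * Q) {a..b}"
      using assms
      by (intro has_integral_add has_integral_mult_left has_integral_powr_affine)
         (auto simp: divide_simps)
    moreover have "- 1 / (b - a) * x + b / (b - a) = (b - x) / (b - a)"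
      "1 / (b - a) * x + - a / (b - a) = (x - a) / (b - a)" for x
      by (auto simp: diff_divide_distrib)
    ultimately have "(w has_integral (b - a) * P / (s + 1) + (b - a) * Q / (s + 1)) {a..b}"
      using \<open>a < b\<close> unfolding w_def[abs_def] by simp
    then show ?thesis by (simp add: B_def distrib_left add_divide_distrib)
  qed
  have "integral {a..b} (\<lambda>x. \<bar>k x\<bar> * w x powr (1 / q)) \<le> A powr (1 / p) * B powr (1 / q)"
  \<comment> \<open>\<open>Holder_integral_le\<close> requires positive integrals, so the vanishing
    majorant is treated directly.\<close>
  proof (cases "P + Q = 0")
    case True
    then have "P = 0" "Q = 0" using PQ by auto
    then show ?thesis by (simp add: w_def)
  next
    case False
    then have "B > 0" using assms by (simp add: B_def)
    moreover have "((\<lambda>x. (w x powr (1 / q)) powr q) has_integral B) {a..b}"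
      using B pq w0 by (simp add: powr_powr)
    ultimately show ?thesis
      using pq A Apos by (intro Holder_integral_le integrable_continuous_real[OF cont]) auto
  qed
  also have "A powr (1 / p) * B powr (1 / q) \<le> (b - a) * gap_const p s r * (P + Q) powr (1 / q)"
  proof -
    have q: "1 / q = 1 - 1 / p" using pq by simp
    \<comment> \<open>Subadditivity with exponent \<open>1 / p \<le> 1\<close> produces the
      numerator of \<open>gap_const\<close>.\<close>
    have "(1 + r powr (p + 1)) powr (1 / p) \<le> 1 + (r powr (p + 1)) powr (1 / p)"
      using pq by (intro one_plus_powr_le) auto
    then have R: "(1 + r powr (p + 1)) powr (1 / p) \<le> 1 + r powr ((p + 1) / p)"
      by (simp add: powr_powr)
    \<comment> \<open>Conjugacy of the exponents recombines the two powers of the length into one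
      factor \<open>b - a\<close>.\<close>
    have ba: "(b - a) powr (1 / p) * (b - a) powr (1 / q) = b - a"
      using \<open>a < b\<close> pq by (simp flip: powr_add)
    have r1: "((r + 1) powr (p + 1)) powr (1 / p) = (r + 1) * (r + 1) powr (1 / p)"
    proof -
      have "((r + 1) powr (p + 1)) powr (1 / p) = (r + 1) powr (1 + 1 / p)"
        using pq by (simp add: powr_powr add_divide_distrib)
      then show ?thesis using assms by (simp add: powr_add)
    qed
    have Ae: "A powr (1 / p) = (b - a) powr (1 / p) * (1 + r powr (p + 1)) powr (1 / p)
        / ((p + 1) powr (1 / p) * ((r + 1) * (r + 1) powr (1 / p)))"
      unfolding A_def using assms by (simp add: powr_mult powr_divide r1)
    have Be: "B powr (1 / q) = (b - a) powr (1 / q) * (P + Q) powr (1 / q) / (s + 1) powr (1 / q)"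
      unfolding B_def using assms by (simp add: powr_mult powr_divide)
    have "A powr (1 / p) * B powr (1 / q) =
        ((b - a) powr (1 / p) * (b - a) powr (1 / q)) * ((1 + r powr (p + 1)) powr (1 / p) * (P + Q) powr (1 / q))
        / ((p + 1) powr (1 / p) * ((r + 1) * (r + 1) powr (1 / p)) * (s + 1) powr (1 / q))"
      unfolding Ae Be by simp
    also have "\<dots> \<le> (b - a) * ((1 + r powr ((p + 1) / p)) * (P + Q) powr (1 / q))
        / ((p + 1) powr (1 / p) * ((r + 1) * (r + 1) powr (1 / p)) * (s + 1) powr (1 / q))"
      unfolding ba using assms R
      by (intro divide_right_mono mult_left_mono mult_right_mono) auto
    also have "\<dots> = (b - a) * gap_const p s r * (P + Q) powr (1 / q)"
      by (simp add: gap_const_def q mult_ac)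
    finally show ?thesis .
  qed
  finally show ?thesis using 1 by linarith
qed

text \<open>The weights \<open>1 / (r + 1)\<close> and \<open>r / (r + 1)\<close> sum to one, so the
  endpoint average and the mean shift by the same \<open>c\<close>.\<close>

lemma endpoint_gap_diff_const:
  assumes "a < b" "0 \<le> r" "h integrable_on {a..b}"
  shows "endpoint_gap r a b (\<lambda>x. h x - c) = endpoint_gap r a b h"
proof -
  have "integral {a..b} (\<lambda>x. h x - c) = integral {a..b} h - (b - a) * c"
    using assms by (subst integral_diff) auto
  moreover have "(b - a) * c / (b - a) = c" "((1 + r) * c) / (r + 1) = c"
    using assms by (auto simp: add.commute)
  moreover have "h a - c + r * (h b - c) = h a + r * h b - (1 + r) * c"
    by (simp add: algebra_simps)
  ultimately show ?thesis
    unfolding endpoint_gap_def by (simp only: diff_divide_distrib)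
qed

section \<open>Continuity from absolute continuity, bounds from s-convexity\<close>

text \<open>The family consisting of the single interval between two points already gives the
  epsilon-delta condition.\<close>

lemma abs_cont_on_imp_continuous_on:
  assumes "abs_cont_on a b h"
  shows "continuous_on {a..b} h"
  unfolding continuous_on_iff
proof (intro ballI allI impI)
  fix x e :: real assume x: "x \<in> {a..b}" and "0 < e"
  then obtain \<delta> where "\<delta> > 0" and \<delta>: "\<And>D S. D division_of S \<Longrightarrow> S \<subseteq> {a..b} \<Longrightarrow>
      (\<Sum>K\<in>D. measure lborel K) < \<delta> \<Longrightarrow>
      (\<Sum>K\<in>D. \<bar>h (interval_upperbound K) - h (interval_lowerbound K)\<bar>) < e"
    using assms unfolding abs_cont_on_def by meson
  have *: "\<bar>h v - h u\<bar> < e" if "u \<in> {a..b}" "v \<in> {a..b}" "u \<le> v" "v - u < \<delta>" for u v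
    using \<delta>[OF division_of_self[of u v]] that by auto
  have "dist (h y) (h x) < e" if "y \<in> {a..b}" "dist y x < \<delta>" for y
    using *[of x y] *[of y x] x that by (cases "x \<le> y") (auto simp: dist_real_def)
  then show "\<exists>d>0. \<forall>y\<in>{a..b}. dist y x < d \<longrightarrow> dist (h y) (h x) < e"
    using \<open>\<delta> > 0\<close> by blast
qed

text \<open>\<open>x\<close> is the convex combination of \<open>a\<close> and \<open>b\<close> with
  these coefficients. The right-hand side has the form of the majorant in
  \<open>endpoint_gap_bound\<close>.\<close>

lemma s_convex_on_Icc_le:
  assumes "s_convex_on s {a..b} h" "a < b" "x \<in> {a..b}"
  shows "h x \<le> ((b - x) / (b - a)) powr s * h a + ((x - a) / (b - a)) powr s * h b"
proof -
  have "(b - x) / (b - a) * a + (x - a) / (b - a) * b = x"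
  proof -
    have "(b - x) * a + (x - a) * b = x * (b - a)" by (simp add: algebra_simps)
    then show ?thesis using assms by (simp flip: add_divide_distrib)
  qed
  moreover have "(b - x) / (b - a) + (x - a) / (b - a) = 1"
    using assms by (simp flip: add_divide_distrib)
  moreover have "0 \<le> (b - x) / (b - a)" "0 \<le> (x - a) / (b - a)"
    using assms by auto
  ultimately show ?thesis
    using assms unfolding s_convex_on_def by (metis atLeastAtMost_iff less_imp_le order_refl)
qed

text \<open>Each weight is at most one. This cruder bound serves to show that \<open>f'\<close> is
  bounded on the rectangle.\<close>

lemma s_convex_on_Icc_le_sum:
  assumes "s_convex_on s {a..b} h" "a < b" "0 \<le> s" "x \<in> {a..b}" "0 \<le> h a" "0 \<le> h b"
  shows "h x \<le> h a + h b"
proof -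
  have "((b - x) / (b - a)) powr s \<le> 1" "((x - a) / (b - a)) powr s \<le> 1"
    using assms by (auto intro!: powr_le1)
  then have "((b - x) / (b - a)) powr s * h a + ((x - a) / (b - a)) powr s * h b \<le> 1 * h a + 1 * h b"
    using assms by (intro add_mono mult_right_mono) auto
  with s_convex_on_Icc_le[OF assms(1,2,4)] show ?thesis by simp
qed

section \<open>Consequences of bounded derivatives\<close>

lemma Lipschitz_of_deriv_bound:
  fixes h :: "real \<Rightarrow> real"
  assumes "\<And>x. x \<in> {a..b} \<Longrightarrow> (h has_real_derivative h' x) (at x within {a..b})"
    and "\<And>x. x \<in> {a..b} \<Longrightarrow> \<bar>h' x\<bar> \<le> M"
    and "x \<in> {a..b}" "y \<in> {a..b}"
  shows "\<bar>h x - h y\<bar> \<le> M * \<bar>x - y\<bar>"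
  using field_differentiable_bound[of "{a..b}" h h' M x y] assms by auto

text \<open>Along sequences tending to \<open>y\<close>, the mean value theorem bounds the
  difference quotients by \<open>M\<close>, so dominated convergence applies. About \<open>G\<close>
  only pointwise information enters; its integrability comes with the limit.\<close>

lemma has_real_derivative_integral_parametric:
  fixes H G :: "real \<Rightarrow> real \<Rightarrow> real"
  assumes int: "\<And>y. y \<in> {c..d} \<Longrightarrow> (\<lambda>x. H x y) integrable_on {a..b}"
    and der: "\<And>x y. x \<in> {a..b} \<Longrightarrow> y \<in> {c..d} \<Longrightarrow>
      (H x has_real_derivative G x y) (at y within {c..d})"
    and bound: "\<And>x y. x \<in> {a..b} \<Longrightarrow> y \<in> {c..d} \<Longrightarrow> \<bar>G x y\<bar> \<le> M"
    and y: "y \<in> {c..d}"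
  shows "((\<lambda>y. integral {a..b} (\<lambda>x. H x y)) has_real_derivative integral {a..b} (\<lambda>x. G x y))
    (at y within {c..d})"
  unfolding has_field_derivative_iff tendsto_at_iff_sequentially comp_def
proof (intro allI impI)
  fix Y :: "nat \<Rightarrow> real" assume Y: "\<forall>i. Y i \<in> {c..d} - {y}" "Y \<longlonglongrightarrow> y"
  define q where "q i x = (H x (Y i) - H x y) / (Y i - y)" for i x
  have "(\<lambda>i. integral {a..b} (q i)) \<longlonglongrightarrow> integral {a..b} (\<lambda>x. G x y)"
  proof (rule dominated_convergence(2))
    show "q i integrable_on {a..b}" for i
      unfolding q_def using Y y by (intro integrable_on_divide integrable_diff int) auto
    show "(\<lambda>x. M) integrable_on {a..b}" by auto
    show "norm (q i x) \<le> M" if x: "x \<in> {a..b}" for i x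
    proof -
      have "\<bar>H x (Y i) - H x y\<bar> \<le> M * \<bar>Y i - y\<bar>"
        using Y y x by (intro Lipschitz_of_deriv_bound[OF der bound]) auto
      moreover have "\<bar>Y i - y\<bar> > 0" using Y by auto
      ultimately show ?thesis by (simp add: q_def divide_simps)
    qed
    show "(\<lambda>i. q i x) \<longlonglongrightarrow> G x y" if x: "x \<in> {a..b}" for x
      using der[OF x y] Y
      unfolding has_field_derivative_iff tendsto_at_iff_sequentially comp_def q_def by auto
  qed
  moreover have "integral {a..b} (q i) =
      (integral {a..b} (\<lambda>x. H x (Y i)) - integral {a..b} (\<lambda>x. H x y)) / (Y i - y)" for i
    unfolding q_def using Y y by (simp add: integral_diff int)
  ultimately show "(\<lambda>i. (integral {a..b} (\<lambda>x. H x (Y i)) - integral {a..b} (\<lambda>x. H x y)) / (Y i - y))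
      \<longlonglongrightarrow> integral {a..b} (\<lambda>x. G x y)" by simp
qed

text \<open>The boundedness of \<open>f'\<close> makes the mixed differences of \<open>f\<close> jointly Lipschitz, so joint
  continuity of \<open>f\<close> only needs continuity along two edges.\<close>

lemma mixed_diff_le:
  fixes f g f' :: "real \<times> real \<Rightarrow> real"
  assumes derf: "\<And>x y. x \<in> {a..b} \<Longrightarrow> y \<in> {c..d} \<Longrightarrow>
      ((\<lambda>v. f (x, v)) has_real_derivative g (x, y)) (at y within {c..d})"
    and derg: "\<And>x y. x \<in> {a..b} \<Longrightarrow> y \<in> {c..d} \<Longrightarrow>
      ((\<lambda>u. g (u, y)) has_real_derivative f' (x, y)) (at x within {a..b})"
    and bound: "\<And>x y. x \<in> {a..b} \<Longrightarrow> y \<in> {c..d} \<Longrightarrow> \<bar>f' (x, y)\<bar> \<le> M"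
    and "x \<in> {a..b}" "x' \<in> {a..b}" "y \<in> {c..d}" "y' \<in> {c..d}"
  shows "\<bar>(f (x, y) - f (x', y)) - (f (x, y') - f (x', y'))\<bar> \<le> M * \<bar>x - x'\<bar> * \<bar>y - y'\<bar>"
proof -
  have "((\<lambda>v. f (x, v) - f (x', v)) has_real_derivative g (x, v) - g (x', v)) (at v within {c..d})"
    if "v \<in> {c..d}" for v
    using assms that by (intro DERIV_diff derf) auto
  \<comment> \<open>Two mean value bounds are nested: in the first variable for \<open>g\<close>,
    with derivative \<open>f'\<close>, then in the second for the difference of two sections of
    \<open>f\<close>.\<close>
  moreover have "\<bar>g (x, v) - g (x', v)\<bar> \<le> M * \<bar>x - x'\<bar>" if "v \<in> {c..d}" for v
    using that assms by (intro Lipschitz_of_deriv_bound[where h = "\<lambda>u. g (u, v)", OF derg bound]) auto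
  ultimately show ?thesis
    using assms
    by (intro Lipschitz_of_deriv_bound[where h = "\<lambda>v. f (x, v) - f (x', v)"
          and h' = "\<lambda>v. g (x, v) - g (x', v)"]) auto
qed

lemma continuous_on_of_bounded_mixed_partial:
  fixes f g f' :: "real \<times> real \<Rightarrow> real"
  assumes "a \<le> b" "c \<le> d"
    and derf: "\<And>x y. x \<in> {a..b} \<Longrightarrow> y \<in> {c..d} \<Longrightarrow>
      ((\<lambda>v. f (x, v)) has_real_derivative g (x, y)) (at y within {c..d})"
    and derg: "\<And>x y. x \<in> {a..b} \<Longrightarrow> y \<in> {c..d} \<Longrightarrow>
      ((\<lambda>u. g (u, y)) has_real_derivative f' (x, y)) (at x within {a..b})"
    and bound: "\<And>x y. x \<in> {a..b} \<Longrightarrow> y \<in> {c..d} \<Longrightarrow> \<bar>f' (x, y)\<bar> \<le> M"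
    and edge: "continuous_on {a..b} (\<lambda>x. f (x, c))"
  shows "continuous_on ({a..b} \<times> {c..d}) f"
proof -
  \<comment> \<open>\<open>E x y\<close> is the increment of \<open>f\<close> over the rectangle
    with corners \<open>(a, c)\<close> and \<open>(x, y)\<close>; adding back the edge values
    recovers \<open>f\<close>.\<close>
  define E where "E x y = f (x, y) - f (x, c) - f (a, y) + f (a, c)" for x y
  have "\<bar>f' (a, c)\<bar> \<le> M" using bound assms by auto
  then have "0 \<le> M" by linarith
  have E: "\<bar>E x y - E x' y'\<bar> \<le> M * \<bar>x - x'\<bar> * (d - c) + M * (b - a) * \<bar>y - y'\<bar>"
    if "x \<in> {a..b}" "x' \<in> {a..b}" "y \<in> {c..d}" "y' \<in> {c..d}" for x y x' y'
  proof -
    \<comment> \<open>One variable is changed at a time, passing from \<open>(x, y)\<close> to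
      \<open>(x', y')\<close> through \<open>(x', y)\<close>.\<close>
    have "\<bar>(f (x, y) - f (x', y)) - (f (x, c) - f (x', c))\<bar> \<le> M * \<bar>x - x'\<bar> * \<bar>y - c\<bar>"
      using assms that by (intro mixed_diff_le[OF derf derg bound]) auto
    also have "\<dots> \<le> M * \<bar>x - x'\<bar> * (d - c)"
      using that \<open>0 \<le> M\<close> by (intro mult_left_mono) auto
    finally have 1: "\<bar>E x y - E x' y\<bar> \<le> M * \<bar>x - x'\<bar> * (d - c)"
      by (simp add: E_def algebra_simps)
    have "\<bar>(f (x', y) - f (a, y)) - (f (x', y') - f (a, y'))\<bar> \<le> M * \<bar>x' - a\<bar> * \<bar>y - y'\<bar>"
      using assms that by (intro mixed_diff_le[OF derf derg bound]) auto
    also have "\<dots> \<le> M * (b - a) * \<bar>y - y'\<bar>"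
      using that \<open>0 \<le> M\<close> by (intro mult_right_mono mult_left_mono) auto
    finally have "\<bar>E x' y - E x' y'\<bar> \<le> M * (b - a) * \<bar>y - y'\<bar>"
      by (simp add: E_def algebra_simps)
    with 1 show ?thesis by linarith
  qed
  have contE: "continuous_on ({a..b} \<times> {c..d}) (\<lambda>z. E (fst z) (snd z))"
    unfolding continuous_on_def
  proof
    fix z assume z: "z \<in> {a..b} \<times> {c..d}"
    let ?F = "at z within {a..b} \<times> {c..d}"
    have "((\<lambda>w. E (fst w) (snd w) - E (fst z) (snd z)) \<longlongrightarrow> 0) ?F"
    proof (rule Lim_null_comparison)
      show "\<forall>\<^sub>F w in ?F. norm (E (fst w) (snd w) - E (fst z) (snd z)) \<le>
          M * \<bar>fst w - fst z\<bar> * (d - c) + M * (b - a) * \<bar>snd w - snd z\<bar>"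
        using z E by (auto simp: eventually_at_filter mem_Times_iff intro!: always_eventually)
      have "((\<lambda>w. M * \<bar>fst w - fst z\<bar> * (d - c) + M * (b - a) * \<bar>snd w - snd z\<bar>) \<longlongrightarrow>
          M * \<bar>fst z - fst z\<bar> * (d - c) + M * (b - a) * \<bar>snd z - snd z\<bar>) ?F"
        by (intro tendsto_intros)
      then show "((\<lambda>w. M * \<bar>fst w - fst z\<bar> * (d - c) + M * (b - a) * \<bar>snd w - snd z\<bar>) \<longlongrightarrow> 0) ?F"
        by simp
    qed
    then show "((\<lambda>w. E (fst w) (snd w)) \<longlongrightarrow> E (fst z) (snd z)) ?F"
      by (simp add: LIM_zero_iff)
  qed
  \<comment> \<open>On the edge over \<open>a\<close>, continuity comes from differentiability in
    the second variable.\<close>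
  have edge': "continuous_on {c..d} (\<lambda>y. f (a, y))"
    using derf \<open>a \<le> b\<close> by (intro DERIV_continuous_on) auto
  have "continuous_on ({a..b} \<times> {c..d})
      (\<lambda>z. E (fst z) (snd z) + f (fst z, c) + f (a, snd z) - f (a, c))"
    by (intro continuous_intros contE continuous_on_compose2[OF edge] continuous_on_compose2[OF edge'])
       auto
  then show ?thesis by (simp add: E_def)
qed

text \<open>\<open>g (x, \<cdot>)\<close> itself may be unbounded; only \<open>g (x, y) - g (a, y)\<close> is controlled by \<open>f'\<close>.
  This suffices because \<open>endpoint_gap\<close> annihilates constants.\<close>

lemma has_real_derivative_endpoint_gap:
  fixes f g f' :: "real \<times> real \<Rightarrow> real"
  assumes "a < b" "0 \<le> r"
    and derf: "\<And>x y. x \<in> {a..b} \<Longrightarrow> y \<in> {c..d} \<Longrightarrow>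
      ((\<lambda>v. f (x, v)) has_real_derivative g (x, y)) (at y within {c..d})"
    and derg: "\<And>x y. x \<in> {a..b} \<Longrightarrow> y \<in> {c..d} \<Longrightarrow>
      ((\<lambda>u. g (u, y)) has_real_derivative f' (x, y)) (at x within {a..b})"
    and bound: "\<And>x y. x \<in> {a..b} \<Longrightarrow> y \<in> {c..d} \<Longrightarrow> \<bar>f' (x, y)\<bar> \<le> M"
    and int: "\<And>y. y \<in> {c..d} \<Longrightarrow> (\<lambda>x. f (x, y)) integrable_on {a..b}"
    and y: "y \<in> {c..d}"
  shows "((\<lambda>y. endpoint_gap r a b (\<lambda>x. f (x, y))) has_real_derivative
      endpoint_gap r a b (\<lambda>x. g (x, y))) (at y within {c..d})"
proof -
  define H where "H x y = f (x, y) - f (a, y)" for x y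
  define G where "G x y = g (x, y) - g (a, y)" for x y
  have "\<bar>f' (a, y)\<bar> \<le> M" using bound assms by auto
  then have "0 \<le> M" by linarith
  have derH: "(H x has_real_derivative G x y) (at y within {c..d})" if "x \<in> {a..b}" "y \<in> {c..d}" for x y
    unfolding H_def G_def using that \<open>a < b\<close> by (intro DERIV_diff derf) auto
  have intH: "(\<lambda>x. H x y) integrable_on {a..b}" if "y \<in> {c..d}" for y
    unfolding H_def using int[OF that] by (intro integrable_diff) auto
  have boundG: "\<bar>G x y\<bar> \<le> M * (b - a)" if "x \<in> {a..b}" "y \<in> {c..d}" for x y
  proof -
    have "\<bar>G x y\<bar> \<le> M * \<bar>x - a\<bar>"
      unfolding G_def using that \<open>a < b\<close>
      by (intro Lipschitz_of_deriv_bound[where h = "\<lambda>u. g (u, y)", OF derg bound]) auto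
    also have "\<dots> \<le> M * (b - a)" using that \<open>0 \<le> M\<close> by (intro mult_left_mono) auto
    finally show ?thesis .
  qed
  have *: "((\<lambda>y. endpoint_gap r a b (\<lambda>x. H x y)) has_real_derivative
      endpoint_gap r a b (\<lambda>x. G x y)) (at y within {c..d})"
    unfolding endpoint_gap_def using assms(1,2) y
    by (intro DERIV_diff DERIV_cdivide DERIV_add DERIV_cmult derH
          has_real_derivative_integral_parametric[OF intH derH boundG]) auto
  have "(\<lambda>x. g (x, y)) integrable_on {a..b}"
    using derg[OF _ y] by (intro integrable_continuous_real DERIV_continuous_on)
  then have "endpoint_gap r a b (\<lambda>x. G x y) = endpoint_gap r a b (\<lambda>x. g (x, y))"
    unfolding G_def using assms by (intro endpoint_gap_diff_const) auto
  moreover have "endpoint_gap r a b (\<lambda>x. H x y) = endpoint_gap r a b (\<lambda>x. f (x, y))"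
    if "y \<in> {c..d}" for y
    unfolding H_def using assms that by (intro endpoint_gap_diff_const) auto
  \<comment> \<open>The two functions of \<open>y\<close> are known to agree on
    \<open>{c..d}\<close> only, so the derivative is transferred within that set; the radius
    \<open>1\<close> is arbitrary.\<close>
  ultimately show ?thesis
    using has_field_derivative_transform_within[OF * zero_less_one y] by simp
qed

section \<open>The estimate on the rectangle\<close>

theorem theorem11:
  fixes a b c d s p q r1 r2 :: real
    and f f' :: "real \<times> real \<Rightarrow> real"
  assumes "0 \<le> a" "a < b" "0 \<le> c" "c < d"
    and "\<forall>z \<in> {a..b} \<times> {c..d}. 0 \<le> f z"
    and "abs_cont2_on a b c d f"
    and "has_mixed_partial_on f f' {a..b} {c..d}"
    and "0 < s" "s \<le> 1"
    and "1 < p" "q = p / (p - 1)"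
    and "0 \<le> r1" "r1 \<le> 1" "0 \<le> r2" "r2 \<le> 1"
    and "coord_s_convex_on s {a..b} {c..d} (\<lambda>z. \<bar>f' z\<bar> powr (p / (p - 1)))"
  shows
    "\<bar>(f (a, c) + r2 * f (a, d) + r1 * f (b, c) + r1 * r2 * f (b, d)) / ((r1 + 1) * (r2 + 1))
      - (r1 / (r1 + 1)) * (1 / (d - c)) * integral {c..d} (\<lambda>y. f (b, y))
      - (1 / (r1 + 1)) * (1 / (d - c)) * integral {c..d} (\<lambda>y. f (a, y))
      - (r2 / (r2 + 1)) * (1 / (b - a)) * integral {a..b} (\<lambda>x. f (x, d))
      - (1 / (r2 + 1)) * (1 / (b - a)) * integral {a..b} (\<lambda>x. f (x, c))
      + 1 / ((b - a) * (d - c)) * integral {a..b} (\<lambda>x. integral {c..d} (\<lambda>y. f (x, y)))\<bar>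
     \<le> (b - a) * (d - c) / ((r1 + 1) * (r2 + 1))
       * ((1 + r1 powr ((p + 1) / p)) * (1 + r2 powr ((p + 1) / p))
          / ((r1 + 1) powr (1 / p) * (r2 + 1) powr (1 / p) * (p + 1) powr (2 / p)))
       * ((\<bar>f' (a, c)\<bar> powr q + \<bar>f' (a, d)\<bar> powr q + \<bar>f' (b, c)\<bar> powr q + \<bar>f' (b, d)\<bar> powr q)
          / (s + 1)\<^sup>2) powr (1 / q)"
proof -
  note r = \<open>0 \<le> r1\<close> \<open>0 \<le> r2\<close>
  have q: "1 < q" "1 / p + 1 / q = 1"
  proof -
    show "1 < q" using \<open>1 < p\<close> \<open>q = p / (p - 1)\<close> by simp
    have "1 / q = 1 - 1 / p"
      using \<open>1 < p\<close> by (simp add: \<open>q = p / (p - 1)\<close> diff_divide_distrib)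
    then show "1 / p + 1 / q = 1" by simp
  qed
  obtain g where derf: "\<And>x y. x \<in> {a..b} \<Longrightarrow> y \<in> {c..d} \<Longrightarrow>
      ((\<lambda>v. f (x, v)) has_real_derivative g (x, y)) (at y within {c..d})"
    and derg: "\<And>x y. x \<in> {a..b} \<Longrightarrow> y \<in> {c..d} \<Longrightarrow>
      ((\<lambda>u. g (u, y)) has_real_derivative f' (x, y)) (at x within {a..b})"
    using assms(7) unfolding has_mixed_partial_on_def by meson
  define w where "w z = \<bar>f' z\<bar> powr q" for z
  have w0: "0 \<le> w z" for z by (simp add: w_def)
  have conv1: "s_convex_on s {a..b} (\<lambda>u. w (u, y))" if "y \<in> {c..d}" for y
    using assms(11,16) that unfolding coord_s_convex_on_def w_def by blast
  have conv2: "s_convex_on s {c..d} (\<lambda>v. w (x, v))" if "x \<in> {a..b}" for x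
    using assms(11,16) that unfolding coord_s_convex_on_def w_def by blast
  define T where "T = w (a, c) + w (a, d) + w (b, c) + w (b, d)"
  \<comment> \<open>Convexity in the first variable and then in the second bounds \<open>w\<close>
    everywhere by the sum of its corner values. This is the uniform bound on \<open>f'\<close>
    behind joint continuity and differentiation under the integral.\<close>
  have bound: "\<bar>f' (x, y)\<bar> \<le> T powr (1 / q)" if "x \<in> {a..b}" "y \<in> {c..d}" for x y
  proof -
    have "w (x, y) \<le> w (a, y) + w (b, y)"
      using s_convex_on_Icc_le_sum[OF conv1[OF that(2)] \<open>a < b\<close>] assms that w0 by simp
    moreover have "w (a, y) \<le> w (a, c) + w (a, d)" "w (b, y) \<le> w (b, c) + w (b, d)"
      using s_convex_on_Icc_le_sum[OF conv2 \<open>c < d\<close>] assms that w0 by simp_all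
    ultimately have "w (x, y) \<le> T" by (simp add: T_def)
    then have "w (x, y) powr (1 / q) \<le> T powr (1 / q)"
      using w0 q by (intro powr_mono2) auto
    then show ?thesis using q by (simp add: w_def powr_powr)
  qed
  have contf: "continuous_on ({a..b} \<times> {c..d}) f"
  proof (rule continuous_on_of_bounded_mixed_partial[OF _ _ derf derg bound])
    show "continuous_on {a..b} (\<lambda>x. f (x, c))"
      using assms(6) unfolding abs_cont2_on_def by (intro abs_cont_on_imp_continuous_on) blast
  qed (use assms in auto)
  have intx: "(\<lambda>x. f (x, y)) integrable_on {a..b}" if "y \<in> {c..d}" for y
    using that by (intro integrable_continuous_real continuous_on_compose2[OF contf] continuous_intros) auto
  have inty: "(\<lambda>y. f (x, y)) integrable_on {c..d}" if "x \<in> {a..b}" for x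
    using that by (intro integrable_continuous_real continuous_on_compose2[OF contf] continuous_intros) auto
  define \<Phi> where "\<Phi> y = endpoint_gap r1 a b (\<lambda>x. f (x, y))" for y
  define \<phi> where "\<phi> y = endpoint_gap r1 a b (\<lambda>x. g (x, y))" for y
  have der\<Phi>: "(\<Phi> has_real_derivative \<phi> y) (at y within {c..d})" if "y \<in> {c..d}" for y
    unfolding \<Phi>_def \<phi>_def
    by (rule has_real_derivative_endpoint_gap[OF \<open>a < b\<close> r(1) derf derg bound intx that])
  define K1 K2 where "K1 = (b - a) * gap_const p s r1" and "K2 = (d - c) * gap_const p s r2"
  have K: "0 \<le> K1" "0 \<le> K2"
    using assms by (auto simp: K1_def K2_def gap_const_def)
  have \<phi>_le: "\<bar>\<phi> y\<bar> \<le> K1 * (w (a, y) + w (b, y)) powr (1 / q)" if y: "y \<in> {c..d}" for y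
    unfolding \<phi>_def K1_def
  proof (rule endpoint_gap_bound[OF \<open>a < b\<close> r(1) \<open>1 < p\<close> q \<open>0 < s\<close> w0 w0 derg[OF _ y]])
    show "\<bar>f' (x, y)\<bar> powr q \<le> ((b - x) / (b - a)) powr s * w (a, y) + ((x - a) / (b - a)) powr s * w (b, y)"
      if "x \<in> {a..b}" for x
      using s_convex_on_Icc_le[OF conv1[OF y] \<open>a < b\<close> that] by (simp add: w_def)
  qed
  \<comment> \<open>Raising the bound on \<open>\<phi>\<close> to the power \<open>q\<close> removes
    the root, and convexity in the second variable then gives the weighted form required of the
    majorant, with \<open>K1 powr q\<close> absorbed into its endpoint values.\<close>
  have "\<bar>endpoint_gap r2 c d \<Phi>\<bar> \<le> K2 * (K1 powr q * (w (a, c) + w (b, c)) + K1 powr q * (w (a, d) + w (b, d))) powr (1 / q)"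
    unfolding K2_def
  proof (rule endpoint_gap_bound[OF \<open>c < d\<close> r(2) \<open>1 < p\<close> q \<open>0 < s\<close> _ _ der\<Phi>])
    fix y assume y: "y \<in> {c..d}"
    let ?\<alpha> = "((d - y) / (d - c)) powr s" and ?\<beta> = "((y - c) / (d - c)) powr s"
    have "\<bar>\<phi> y\<bar> powr q \<le> (K1 * (w (a, y) + w (b, y)) powr (1 / q)) powr q"
      using \<phi>_le[OF y] q by (intro powr_mono2) auto
    also have "\<dots> = K1 powr q * (w (a, y) + w (b, y))"
      using q K w0[of "(a, y)"] w0[of "(b, y)"] by (simp add: powr_mult powr_powr)
    also have "\<dots> \<le> K1 powr q *
        ((?\<alpha> * w (a, c) + ?\<beta> * w (a, d)) + (?\<alpha> * w (b, c) + ?\<beta> * w (b, d)))"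
      using assms y by (intro mult_left_mono add_mono s_convex_on_Icc_le conv2) auto
    finally show "\<bar>\<phi> y\<bar> powr q \<le> ?\<alpha> * (K1 powr q * (w (a, c) + w (b, c)))
        + ?\<beta> * (K1 powr q * (w (a, d) + w (b, d)))"
      by (simp add: algebra_simps)
  qed (use w0 in auto)
  also have "K1 powr q * (w (a, c) + w (b, c)) + K1 powr q * (w (a, d) + w (b, d)) = K1 powr q * T"
    by (simp add: T_def algebra_simps)
  also have "K2 * (K1 powr q * T) powr (1 / q) = K2 * K1 * T powr (1 / q)"
    using q K w0 by (simp add: powr_mult powr_powr T_def)
  also have "\<dots> = (b - a) * (d - c) / ((r1 + 1) * (r2 + 1))
       * ((1 + r1 powr ((p + 1) / p)) * (1 + r2 powr ((p + 1) / p))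
          / ((r1 + 1) powr (1 / p) * (r2 + 1) powr (1 / p) * (p + 1) powr (2 / p)))
       * (T / (s + 1)\<^sup>2) powr (1 / q)"
  proof -
    \<comment> \<open>The two one-dimensional constants merge: equal powers of \<open>p + 1\<close>
      combine to the exponent \<open>2 / p\<close>, and the two factors with \<open>s + 1\<close>
      become the square under the \<open>q\<close>-th root.\<close>
    have "(p + 1) powr (2 / p) = (p + 1) powr (1 / p) * (p + 1) powr (1 / p)"
      by (simp flip: powr_add)
    moreover have "(T / (s + 1)\<^sup>2) powr (1 / q) = T powr (1 / q) / ((s + 1) powr (1 / q) * (s + 1) powr (1 / q))"
      using w0 \<open>0 < s\<close> by (simp add: T_def power2_eq_square powr_divide powr_mult)
    moreover have "1 - 1 / p = 1 / q" using q by simp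
    ultimately show ?thesis by (simp add: K1_def K2_def gap_const_def mult_ac)
  qed
  also have "endpoint_gap r2 c d \<Phi> =
      (f (a, c) + r2 * f (a, d) + r1 * f (b, c) + r1 * r2 * f (b, d)) / ((r1 + 1) * (r2 + 1))
      - (r1 / (r1 + 1)) * (1 / (d - c)) * integral {c..d} (\<lambda>y. f (b, y))
      - (1 / (r1 + 1)) * (1 / (d - c)) * integral {c..d} (\<lambda>y. f (a, y))
      - (r2 / (r2 + 1)) * (1 / (b - a)) * integral {a..b} (\<lambda>x. f (x, d))
      - (1 / (r2 + 1)) * (1 / (b - a)) * integral {a..b} (\<lambda>x. f (x, c))
      + 1 / ((b - a) * (d - c)) * integral {a..b} (\<lambda>x. integral {c..d} (\<lambda>y. f (x, y)))"
  proof -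
    define J where "J = integral {a..b} (\<lambda>x. integral {c..d} (\<lambda>y. f (x, y)))"
    \<comment> \<open>\<open>\<Phi>\<close> integrates over the first variable inside, whereas the
      double integral to be reached has the second inside; joint continuity of \<open>f\<close>
      permits the exchange.\<close>
    have swap: "integral {c..d} (\<lambda>y. integral {a..b} (\<lambda>x. f (x, y))) = J"
      using integral_swap_continuous[of a c b d "\<lambda>x y. f (x, y)"] contf
      by (simp add: J_def cbox_Pair_eq)
    have cont2: "(\<lambda>y. integral {a..b} (\<lambda>x. f (x, y))) integrable_on {c..d}"
    proof -
      have "continuous_on (cbox c d) (\<lambda>y. integral (cbox a b) (\<lambda>x. f (x, y)))"
        by (rule integral_continuous_on_param)
           (auto intro!: continuous_on_compose2[OF contf] continuous_intros simp: case_prod_beta)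
      then show ?thesis by (auto intro: integrable_continuous_real)
    qed
    have "((\<lambda>y. (f (a, y) + r1 * f (b, y)) / (r1 + 1) - integral {a..b} (\<lambda>x. f (x, y)) / (b - a))
        has_integral (integral {c..d} (\<lambda>y. f (a, y)) + r1 * integral {c..d} (\<lambda>y. f (b, y))) / (r1 + 1)
          - J / (b - a)) {c..d}"
      unfolding swap[symmetric] using assms(2)
      by (intro has_integral_diff has_integral_divide has_integral_add has_integral_mult_right
            integrable_integral inty cont2) auto
    then have "integral {c..d} \<Phi> =
        (integral {c..d} (\<lambda>y. f (a, y)) + r1 * integral {c..d} (\<lambda>y. f (b, y))) / (r1 + 1) - J / (b - a)"
      unfolding \<Phi>_def[abs_def] endpoint_gap_def by (rule integral_unique)
    moreover have "(f (a, c) + r2 * f (a, d) + r1 * f (b, c) + r1 * r2 * f (b, d)) / ((r1 + 1) * (r2 + 1))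
        = ((f (a, c) + r1 * f (b, c)) / (r1 + 1) + r2 * ((f (a, d) + r1 * f (b, d)) / (r1 + 1))) / (r2 + 1)"
      using r by (simp add: add_divide_distrib algebra_simps)
    \<comment> \<open>Here \<open>u\<close> and \<open>v\<close> stand for the weighted endpoint
      averages of \<open>f\<close> at heights \<open>c\<close> and \<open>d\<close>,
      \<open>B\<close> and \<open>D\<close> for the side lengths, \<open>R1\<close> and
      \<open>R2\<close> for \<open>r1 + 1\<close> and \<open>r2 + 1\<close>. Free variables reduce
      the regrouping to distributing division.\<close>
    moreover have "(u - Xc / B + r2 * (v - Xd / B)) / R2 - ((Ia + r1 * Ib) / R1 - J / B) / D =
        (u + r2 * v) / R2 - (r1 / R1) * (1 / D) * Ib - (1 / R1) * (1 / D) * Ia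
        - (r2 / R2) * (1 / B) * Xd - (1 / R2) * (1 / B) * Xc + 1 / (B * D) * J"
      for u v Xc Xd Ia Ib B D R1 R2 :: real
      by (simp add: add_divide_distrib diff_divide_distrib algebra_simps)
    ultimately show ?thesis
      unfolding endpoint_gap_def[of r2] \<Phi>_def[of c] \<Phi>_def[of d] endpoint_gap_def[of r1] J_def[symmetric]
      by (simp only:)
  qed
  finally show ?thesis by (simp add: T_def w_def)
qed

end
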